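(* Let $n, k, t$ be integers with $t \geq 1$ and $n \geq (k-t+1)(t+1)$. Let $\mathcal{F}$ be a family of subsets of $[n]=\{1,\dots,n\}$, each of size at most $k$. Suppose that for any $A, B \in \mathcal{F}$ with $|A \cap B| < t$, we have $|A \triangle B| \leq k-t$. Then $$|\mathcal{F}| \leq \binom{n-t}{k-t} + \binom{n-t}{k-1-t} + \cdots + \binom{n-t}{0}.$$
   Context: $A \triangle B$ denotes the symmetric difference $(A\setminus B)\cup(B\setminus A)$. *)

theory Defs
  imports Main
begin

end

(*
  Replacing A by A + x whenever card A < k and A + x is not yet present preserves the hypothesis.
  A family stable under all these moves is t-intersecting: a pair with card (A \<inter> B) < t could be
  enlarged, keeping its intersection, until card A = k, and then A and B are too far apart.

  A t-intersecting family of sets of size at most k is reduced to a ground set of size t by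
  eliminating one point z at a time, in the spirit of the generating-set method of Ahlswede and
  Khachatrian. A set B of the current ground set L is weighted by the number of its extensions to
  a set of size at most k in the full ground set. After shifting z away, only sets E with
  E - z not in the family obstruct the elimination of z, and two of them conflict only if their
  union is L and their sizes add up to card L + t. A conflict-free part of the obstructing sets
  loses z, the others are discarded. Between two different sizes i and card L + t - i, one of the
  two choices never loses weight; for the middle size, the part missing a suitable point works by
  averaging, and exactly there the bound n \<ge> (k - t + 1) (t + 1) is needed.
*)

theory Submission
  imports Defs
begin

section \<open>Compressions of set families\<close>

text \<open>A set whose image is already a member stays put. If \<open>\<phi>\<close> is injective
  where \<open>R\<close> holds, this makes the map injective on \<open>F\<close>, so the size of the
  family is preserved.\<close>

definition compress :: "('a set \<Rightarrow> bool) \<Rightarrow> ('a set \<Rightarrow> 'a set) \<Rightarrow> 'a set set \<Rightarrow> 'a set \<Rightarrow> 'a set"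
  where "compress R \<phi> F A = (if R A \<and> \<phi> A \<notin> F then \<phi> A else A)"

lemma inj_on_compress:
  assumes "inj_on \<phi> {A. R A}"
  shows "inj_on (compress R \<phi> F) F"
  using assms unfolding inj_on_def compress_def by auto

text \<open>Take a family with \<open>Q\<close> minimizing the sum of \<open>f\<close>. If a move by
  \<open>x\<close> led out of it, compressing with \<open>x\<close> would keep \<open>Q\<close> and
  strictly lower the sum.\<close>

lemma ex_compression_stable:
  fixes f :: "'a set \<Rightarrow> nat"
  assumes "Q F"
    and fin: "\<And>G. Q G \<Longrightarrow> finite G"
    and inv: "\<And>G x. Q G \<Longrightarrow> x \<in> X \<Longrightarrow> Q (compress (R x) (\<phi> x) G ` G)"
    and inj: "\<And>x. x \<in> X \<Longrightarrow> inj_on (\<phi> x) {A. R x A}"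
    and dec: "\<And>G x A. Q G \<Longrightarrow> x \<in> X \<Longrightarrow> A \<in> G \<Longrightarrow> R x A \<Longrightarrow> f (\<phi> x A) < f A"
  obtains G where "Q G" "\<And>x A. x \<in> X \<Longrightarrow> A \<in> G \<Longrightarrow> R x A \<Longrightarrow> \<phi> x A \<in> G"
proof -
  obtain G where G: "Q G" and min: "\<And>H. Q H \<Longrightarrow> sum f G \<le> sum f H"
    using ex_has_least_nat[of Q F "sum f"] \<open>Q F\<close> by blast
  have "\<phi> x A \<in> G" if x: "x \<in> X" and A: "A \<in> G" and R: "R x A" for x A
  proof (rule ccontr)
    assume notin: "\<phi> x A \<notin> G"
    let ?c = "compress (R x) (\<phi> x) G"
    have "sum f (?c ` G) = (\<Sum>B\<in>G. f (?c B))"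
      by (simp add: sum.reindex inj_on_compress inj x)
    also have "\<dots> < sum f G"
    proof (rule sum_strict_mono_ex1)
      show "finite G" using fin G by blast
      show "\<forall>B\<in>G. f (?c B) \<le> f B"
        using dec[OF G x] by (auto simp: compress_def less_imp_le)
      show "\<exists>B\<in>G. f (?c B) < f B"
        using dec[OF G x A R] A R notin by (auto simp: compress_def)
    qed
    finally show False using min[OF inv[OF G x]] by simp
  qed
  with G that show ?thesis by blast
qed

definition intersecting :: "nat \<Rightarrow> 'a set set \<Rightarrow> bool"
  where "intersecting t F \<longleftrightarrow> (\<forall>A\<in>F. \<forall>B\<in>F. t \<le> card (A \<inter> B))"

lemma intersectingD: "intersecting t F \<Longrightarrow> A \<in> F \<Longrightarrow> B \<in> F \<Longrightarrow> t \<le> card (A \<inter> B)"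
  by (simp add: intersecting_def)

section \<open>From the distance condition to intersecting families\<close>

text \<open>The hypothesis on pairs, with \<open>t\<close> added on the left rather than subtracted
  on the right, so that truncated subtraction does no harm.\<close>

definition near :: "nat \<Rightarrow> nat \<Rightarrow> 'a set \<Rightarrow> 'a set \<Rightarrow> bool"
  where "near t k A B \<longleftrightarrow> t \<le> card (A \<inter> B) \<or> card ((A - B) \<union> (B - A)) + t \<le> k"

lemma near_sym: "near t k A B \<longleftrightarrow> near t k B A"
  by (simp add: near_def Int_commute Un_commute)

text \<open>Otherwise \<open>card (A - B) + t\<close> alone would already exceed
  \<open>k\<close>.\<close>

lemma near_top_imp_intersecting:
  assumes "finite A" "finite B" "near t k A B" "card A = k"
  shows "t \<le> card (A \<inter> B)"
proof (rule ccontr)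
  assume less: "\<not> t \<le> card (A \<inter> B)"
  have "card (A - B) \<le> card ((A - B) \<union> (B - A))"
    using assms by (intro card_mono) auto
  moreover have "card A = card (A \<inter> B) + card (A - B)"
    using assms card_Int_Diff by blast
  ultimately show False using assms less unfolding near_def by linarith
qed

lemma near_insert:
  assumes "finite A" "finite B" "near t k A (insert x B)" "x \<notin> A" "x \<notin> B"
  shows "near t k (insert x A) B"
proof -
  have "insert x A - B \<union> (B - insert x A) = A - insert x B \<union> (insert x B - A)"
    and "insert x A \<inter> B = A \<inter> insert x B"
    using assms by auto
  with assms show ?thesis unfolding near_def by simp
qed

lemma near_insert_mem:
  assumes "finite A" "finite B" "near t k A B" "x \<notin> A" "x \<in> B"
  shows "near t k (insert x A) B"
proof -
  have "card (insert x A - B \<union> (B - insert x A)) \<le> card (A - B \<union> (B - A))"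
    using assms by (intro card_mono) auto
  moreover have "card (A \<inter> B) \<le> card (insert x A \<inter> B)"
    using assms by (intro card_mono) auto
  ultimately show ?thesis using assms unfolding near_def by linarith
qed

lemma near_insert_insert:
  assumes "finite A" "finite B" "near t k A B" "x \<notin> A" "x \<notin> B"
  shows "near t k (insert x A) (insert x B)"
proof -
  have "insert x A - insert x B \<union> (insert x B - insert x A) = A - B \<union> (B - A)"
    using assms by auto
  moreover have "card (A \<inter> B) \<le> card (insert x A \<inter> insert x B)"
    using assms by (intro card_mono) auto
  ultimately show ?thesis using assms unfolding near_def by auto
qed

text \<open>The delicate case is that \<open>A\<close> moves while \<open>B\<close> stays and lacks
  \<open>x\<close>. Either \<open>insert x B\<close> is already in \<open>F\<close>, and comparing
  it with \<open>A\<close> gives the same intersection and symmetric difference as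
  \<open>insert x A\<close> and \<open>B\<close>; or \<open>card B = k\<close>, and the intersection
  is already large.\<close>

lemma near_up_compression:
  assumes near: "\<And>A B. A \<in> F \<Longrightarrow> B \<in> F \<Longrightarrow> near t k A B"
    and fin: "\<And>A. A \<in> F \<Longrightarrow> finite A \<and> card A \<le> k"
    and c: "c = compress (\<lambda>A. x \<notin> A \<and> card A < k) (insert x) F"
    and A: "A \<in> F" and B: "B \<in> F"
  shows "near t k (c A) (c B)"
proof -
  have c_move: "c C = insert x C" if "x \<notin> C" "card C < k" "insert x C \<notin> F" for C
    using that by (simp add: c compress_def)
  have moved: "near t k (insert x A) B"
    if A: "A \<in> F" and B: "B \<in> F" and xA: "x \<notin> A" and stay: "c B = B" for A B
  proof (cases "x \<in> B")
    case True
    then show ?thesis using near_insert_mem[OF _ _ near[OF A B] xA] fin[OF A] fin[OF B] by simp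
  next
    case xB: False
    show ?thesis
    proof (cases "card B < k")
      case True
      then have "insert x B \<in> F" using stay xB c_move[of B] by auto
      then have "near t k A (insert x B)" by (rule near[OF A])
      from near_insert[OF _ _ this xA xB] show ?thesis using fin[OF A] fin[OF B] by simp
    next
      case False
      then have "t \<le> card (A \<inter> B)"
        using near_top_imp_intersecting[of B A t k] near[OF B A] fin[OF A] fin[OF B]
        by (simp add: Int_commute)
      then show ?thesis using xB by (simp add: near_def)
    qed
  qed
  have c_cases: "c C = C \<or> c C = insert x C \<and> x \<notin> C" for C
    by (simp add: c compress_def)
  consider "c A = A" "c B = B" | "c A = insert x A" "x \<notin> A" "c B = B"
    | "c A = A" "c B = insert x B" "x \<notin> B"
    | "c A = insert x A" "x \<notin> A" "c B = insert x B" "x \<notin> B"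
    using c_cases[of A] c_cases[of B] by argo
  then show ?thesis
  proof cases
    case 1
    then show ?thesis using near[OF A B] by simp
  next
    case 2
    then show ?thesis using moved[OF A B] by simp
  next
    case 3
    then have "near t k (insert x B) A" using moved[OF B A] by blast
    then show ?thesis using 3 by (simp add: near_sym[of t k A])
  next
    case 4
    then show ?thesis using near_insert_insert[OF _ _ near[OF A B]] fin[OF A] fin[OF B] by simp
  qed
qed

lemma ex_intersecting_of_near:
  fixes F :: "'a set set"
  assumes L: "finite L" "k \<le> card L"
    and sub: "\<And>A. A \<in> F \<Longrightarrow> A \<subseteq> L \<and> card A \<le> k"
    and near: "\<And>A B. A \<in> F \<Longrightarrow> B \<in> F \<Longrightarrow> near t k A B"
  obtains G where "card G = card F" "\<forall>A\<in>G. A \<subseteq> L \<and> card A \<le> k" "intersecting t G"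
proof -
  define Q where "Q G \<longleftrightarrow> card G = card F \<and> (\<forall>A\<in>G. A \<subseteq> L \<and> card A \<le> k)
      \<and> (\<forall>A\<in>G. \<forall>B\<in>G. near t k A B)" for G
  let ?R = "\<lambda>x A. x \<notin> A \<and> card A < k"
  have inj: "inj_on (insert x) {A. ?R x A}" for x :: 'a
    by (auto simp: inj_on_def)
  have finQ: "finite A" if "Q G" "A \<in> G" for G A
    by (rule finite_subset[of A L]) (use that L in \<open>auto simp: Q_def\<close>)
  obtain G where G: "Q G"
    and stable: "\<And>x A. x \<in> L \<Longrightarrow> A \<in> G \<Longrightarrow> ?R x A \<Longrightarrow> insert x A \<in> G"
  proof (rule ex_compression_stable[where Q = Q and F = F and X = L and R = ?R
        and \<phi> = insert and f = "\<lambda>A. k - card A"])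
    show "Q F" using sub near by (simp add: Q_def)
    show "finite G" if "Q G" for G
    proof (rule finite_subset)
      show "G \<subseteq> Pow L" using that by (auto simp: Q_def)
    qed (simp add: L)
    show "Q (compress (?R x) (insert x) G ` G)" if G: "Q G" and x: "x \<in> L" for G x
    proof -
      have "card (compress (?R x) (insert x) G ` G) = card F"
        using G inj_on_compress[OF inj] by (simp add: Q_def card_image)
      moreover have "\<forall>A\<in>G. compress (?R x) (insert x) G A \<subseteq> L
          \<and> card (compress (?R x) (insert x) G A) \<le> k"
        using G x finQ[OF G] by (auto simp: Q_def compress_def)
      moreover have "\<forall>A\<in>G. \<forall>B\<in>G. near t k (compress (?R x) (insert x) G A)
          (compress (?R x) (insert x) G B)"
        using near_up_compression[of G t k, OF _ _ refl] G finQ[OF G] by (simp add: Q_def)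
      ultimately show ?thesis by (simp add: Q_def)
    qed
    show "k - card (insert x A) < k - card A" if "Q G" "A \<in> G" "?R x A" for G x A
      using that finQ by fastforce
  qed (use inj in auto)
  have "t \<le> card (A \<inter> B)" if A: "A \<in> G" and B: "B \<in> G" for A B
  proof (rule ccontr)
    assume "\<not> t \<le> card (A \<inter> B)"
    \<comment> \<open>\<open>B\<close> stays fixed and a largest violating \<open>C\<close> is
      chosen; enlarging \<open>C\<close> outside \<open>B\<close> will contradict its
      maximality.\<close>
    define S where "S = {C \<in> G. card (C \<inter> B) < t}"
    have "A \<in> S" using A \<open>\<not> t \<le> card (A \<inter> B)\<close> by (simp add: S_def)
    moreover have "\<forall>C. C \<in> S \<longrightarrow> card C < Suc k" using G by (auto simp: S_def Q_def)
    ultimately obtain C where C: "C \<in> S" and max: "\<And>D. D \<in> S \<Longrightarrow> card D \<le> card C"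
      using ex_has_greatest_nat[of "\<lambda>C. C \<in> S" A card "Suc k"] by blast
    from C have CG: "C \<in> G" and lt: "card (C \<inter> B) < t" by (auto simp: S_def)
    have CB: "near t k C B" "finite C" "finite B" "card C \<le> k" "C \<subseteq> L" "B \<subseteq> L"
      using G CG B finQ[OF G] by (auto simp: Q_def)
    have "card C < k"
      using near_top_imp_intersecting[of C B t k] CB lt by fastforce
    have "card (C \<union> B) = card ((C - B) \<union> (B - C)) + card (C \<inter> B)"
      using CB by (subst card_Un_disjoint[symmetric]) (auto intro: arg_cong[where f = card])
    \<comment> \<open>A small intersection forces the symmetric difference plus \<open>t\<close> to
      be at most \<open>k\<close>, so the union has fewer than \<open>k \<le> card L\<close> points
      and some \<open>x\<close> avoids both sets.\<close>
    with CB lt L have "card (C \<union> B) < card L" by (auto simp: near_def)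
    then obtain x where "x \<in> L" "x \<notin> C" "x \<notin> B"
      using CB by (metis Un_iff card_mono finite_UnI leD subsetI)
    then have "insert x C \<in> S"
      using stable CG \<open>card C < k\<close> lt by (simp add: S_def)
    from max[OF this] show False using CB \<open>x \<notin> C\<close> by simp
  qed
  then have "intersecting t G" by (simp add: intersecting_def)
  with G show ?thesis by (intro that[of G]) (simp_all add: Q_def)
qed

section \<open>Eliminating one point of an intersecting family\<close>

text \<open>The number of sets of size at most \<open>k\<close> whose trace on the already eliminated part, which
  leaves \<open>d\<close> free points, is a given set of size \<open>i\<close>; truncation makes it \<open>0\<close> for \<open>i > k\<close>.\<close>

definition extensions :: "nat \<Rightarrow> nat \<Rightarrow> nat \<Rightarrow> nat"
  where "extensions k d i = (\<Sum>q<k + 1 - i. d choose q)"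

text \<open>Pascal's rule: the additional free point is either left out or added to the trace, whose
  size then becomes \<open>Suc i\<close>.\<close>

lemma extensions_Suc: "extensions k (Suc d) i = extensions k d i + extensions k d (Suc i)"
proof (cases "i \<le> k")
  case True
  then obtain m where "k = i + m" using le_Suc_ex by blast
  then have "k + 1 - i = Suc m" "k + 1 - Suc i = m" by auto
  then show ?thesis
    unfolding extensions_def
    by (simp only:) (simp add: sum.lessThan_Suc_shift sum.distrib del: sum.lessThan_Suc)
qed (simp add: extensions_def)

lemma extensions_antimono: "i \<le> j \<Longrightarrow> extensions k d j \<le> extensions k d i"
  unfolding extensions_def by (intro sum_mono2) auto

text \<open>The sums are compared term by term. Consecutive binomials have ratio
  \<open>(n - l - q) / (q + 1)\<close>, so it suffices that
  \<open>(i - 1) * (q + 1) \<le> (l - i) * (n - l - q)\<close>, which the lower bound on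
  \<open>n\<close> provides.\<close>

lemma extensions_middle:
  assumes n: "(k - t + 1) * (t + 1) \<le> n" and t: "1 \<le> t" "t < l" "l \<le> n"
    and i: "2 * i = l + t"
  shows "(i - 1) * extensions k (n - l) i \<le> (l - i) * extensions k (n - l) (i - 1)"
proof (cases "i \<le> k")
  case True
  \<comment> \<open>This turns \<open>l - i\<close> into \<open>s\<close> and \<open>l\<close> into
    \<open>t + 2 * s\<close>.\<close>
  define s where "s = i - t"
  have s: "i = t + s" "l = t + 2 * s" "1 \<le> s" using i t by (auto simp: s_def)
  obtain u where u: "t = Suc u" using t by (cases t) auto
  have term_le: "(i - 1) * ((n - l) choose q) \<le> (l - i) * ((n - l) choose Suc q)"
    if q: "q < k + 1 - i" for q
  proof -
    have "i + q \<le> k" using q True by linarith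
    then obtain p where p: "k = i + q + p" using le_Suc_ex by blast
    have "k - t = s + q + p" using p s by simp
    with n have "(s + q + p + 1) * (u + 2) \<le> n" using u by simp
    moreover have "(s + q + p + 1) * (u + 2)
        = (s * u + q * u + q + 1) + (t + 2 * s + q) + (p * u + 2 * p)"
      using u by (simp add: algebra_simps)
    ultimately have room: "s * u + q * u + q + 1 \<le> n - l - q" using s by linarith
    have "u * (q + 1) \<le> s * (s * u + q * u)"
    proof -
      have "1 * (1 * u + q * u) \<le> s * (s * u + q * u)"
        using s by (intro mult_le_mono add_le_mono) auto
      then show ?thesis by (simp add: algebra_simps)
    qed
    then have "(i - 1) * (q + 1) \<le> s * (s * u + q * u + q + 1)"
      using s u by (simp add: algebra_simps)
    also have "\<dots> \<le> s * (n - l - q)" using room by (rule mult_le_mono2)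
    finally have coef: "(i - 1) * (q + 1) \<le> (l - i) * (n - l - q)" using s by simp
    have absorb: "(n - l - q) * ((n - l) choose q) = Suc q * ((n - l) choose Suc q)"
      by (metis binomial_absorb_comp binomial_absorption)
    have "Suc q * ((i - 1) * ((n - l) choose q)) = (i - 1) * (q + 1) * ((n - l) choose q)"
      by (simp add: algebra_simps)
    also have "\<dots> \<le> (l - i) * (n - l - q) * ((n - l) choose q)"
      using coef by (rule mult_le_mono1)
    also have "\<dots> = Suc q * ((l - i) * ((n - l) choose Suc q))"
      using absorb by (metis mult.assoc mult.left_commute)
    finally show ?thesis by (metis Suc_mult_le_cancel1)
  qed
  have "(i - 1) * extensions k (n - l) i \<le> (\<Sum>q<k + 1 - i. (l - i) * ((n - l) choose Suc q))"
    unfolding extensions_def sum_distrib_left by (intro sum_mono term_le) auto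
  \<comment> \<open>The sum for \<open>i - 1\<close> has one more term; shifting the index drops its
    term at \<open>q = 0\<close>.\<close>
  also have "\<dots> \<le> (l - i) * (\<Sum>q<Suc (k + 1 - i). (n - l) choose q)"
    by (subst sum.lessThan_Suc_shift) (simp add: sum_distrib_left[symmetric])
  also have "Suc (k + 1 - i) = k + 1 - (i - 1)" using True s t by simp
  finally show ?thesis by (simp add: extensions_def)
qed (simp add: extensions_def)

section \<open>Selecting a conflict-free part\<close>

text \<open>Double counting of the pairs of a set \<open>E\<close> in \<open>T\<close> and a point
  of \<open>L - E\<close>: some point reaches the average.\<close>

lemma ex_point_avoided:
  assumes "finite L" "finite T" "\<And>E. E \<in> T \<Longrightarrow> E \<subseteq> L \<and> card E = i"
    and "L \<noteq> {}"
  obtains x where "x \<in> L" "card T * (card L - i) \<le> card L * card {E \<in> T. x \<notin> E}"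
proof (rule ccontr)
  assume "\<not> thesis"
  with that have less: "\<And>x. x \<in> L \<Longrightarrow> card L * card {E \<in> T. x \<notin> E} < card T * (card L - i)"
    using not_le by blast
  have "card L * (\<Sum>x\<in>L. card {E \<in> T. x \<notin> E}) < (\<Sum>x\<in>L. card T * (card L - i))"
    unfolding sum_distrib_left using less assms by (intro sum_strict_mono) auto
  moreover have "(\<Sum>x\<in>L. card {E \<in> T. x \<notin> E}) = (\<Sum>E\<in>T. card {x \<in> L. x \<notin> E})"
    using assms by (intro sum_multicount_gen) auto
  moreover have "(\<Sum>E\<in>T. card {x \<in> L. x \<notin> E}) = (\<Sum>E\<in>T. card L - i)"
  proof (rule sum.cong)
    fix E assume "E \<in> T"
    then have "E \<subseteq> L" "card E = i" using assms by auto
    moreover have "{x \<in> L. x \<notin> E} = L - E" by auto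
    ultimately show "card {x \<in> L. x \<notin> E} = card L - i"
      using assms by (metis card_Diff_subset finite_subset)
  qed simp
  ultimately show False by simp
qed

lemma inj_on_remove: "(\<And>A. A \<in> F \<Longrightarrow> z \<in> A) \<Longrightarrow> inj_on (\<lambda>A. A - {z}) F"
  by (rule inj_on_inverseI[where g = "insert z"]) (simp add: insert_absorb)

text \<open>The sets of \<open>H\<close> gain the weight \<open>w (card E - 1)\<close> of \<open>E - {z}\<close>, the discarded sets lose
  \<open>w (card E)\<close>.\<close>

lemma select_uncrossed_class:
  fixes g :: "'a set set" and w :: "nat \<Rightarrow> nat"
  assumes L: "finite L" "z \<in> L" "2 \<le> card L"
    and g: "\<And>E. E \<in> g \<Longrightarrow> E \<subseteq> L \<and> z \<in> E \<and> (card E = i \<or> card E = j)"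
    and sum_ij: "i \<le> j" "i + j = card L + t"
    and anti: "\<And>a b. a \<le> b \<Longrightarrow> w b \<le> w a"
    and middle: "i = j \<Longrightarrow> (i - 1) * w i \<le> (card L - i) * w (i - 1)"
  obtains H where "H \<subseteq> g"
    "\<And>A B. A \<in> H \<Longrightarrow> B \<in> H \<Longrightarrow> card A + card B = card L + t \<Longrightarrow> A \<union> B \<noteq> L"
    "(\<Sum>E\<in>g - H. w (card E)) \<le> (\<Sum>E\<in>H. w (card E - 1))"
proof (cases "i = j")
  case False
  \<comment> \<open>Two sets of the same size cannot conflict here, since neither
    \<open>2 * i\<close> nor \<open>2 * j\<close> equals \<open>i + j\<close>; either size class can
    thus be kept whole.\<close>
  define a b where "a = {E \<in> g. card E = i}" and "b = {E \<in> g. card E = j}"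
  have gab: "g - a = b" "g - b = a" using g False by (auto simp: a_def b_def)
  have const: "(\<Sum>E\<in>a. f (card E)) = card a * f i" "(\<Sum>E\<in>b. f (card E)) = card b * f j"
    for f :: "nat \<Rightarrow> nat"
    by (auto simp: a_def b_def)
  show ?thesis
  proof (cases "card b * w j \<le> card a * w (i - 1)")
    case True
    show ?thesis
    proof (rule that[of a])
      show "(\<Sum>E\<in>g - a. w (card E)) \<le> (\<Sum>E\<in>a. w (card E - 1))"
        using True const(1)[of "\<lambda>m. w (m - 1)"] const(2)[of w] gab by simp
    qed (use False sum_ij in \<open>auto simp: a_def\<close>)
  next
    case larger: False
    \<comment> \<open>If keeping \<open>a\<close> fails, keeping \<open>b\<close> succeeds: the
      failed inequality fits between two uses of the monotonicity of \<open>w\<close>.\<close>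
    have "card a * w i \<le> card a * w (i - 1)" by (simp add: anti)
    also have "\<dots> \<le> card b * w j" using larger by simp
    also have "\<dots> \<le> card b * w (j - 1)" by (simp add: anti)
    finally have le: "card a * w i \<le> card b * w (j - 1)" .
    show ?thesis
    proof (rule that[of b])
      show "(\<Sum>E\<in>g - b. w (card E)) \<le> (\<Sum>E\<in>b. w (card E - 1))"
        using le const(2)[of "\<lambda>m. w (m - 1)"] const(1)[of w] gab by simp
    qed (use False sum_ij in \<open>auto simp: b_def\<close>)
  qed
next
  case True
  \<comment> \<open>Every set contains \<open>z\<close>, so the averaging runs over the remaining
    points \<open>L - {z}\<close>.\<close>
  define T where "T = (\<lambda>E. E - {z}) ` g"
  have inj: "inj_on (\<lambda>E. E - {z}) g" using g by (intro inj_on_remove) blast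
  have "g \<subseteq> Pow L" using g by (meson PowI subsetI)
  then have fin: "finite g" using L by (meson finite_Pow_iff finite_subset)
  have card_g: "card E = i" if "E \<in> g" for E using g[OF that] True by simp
  have L': "card (L - {z}) = card L - 1" using L by (simp add: card_Diff_singleton)
  then have "card (L - {z}) \<noteq> 0" using L by linarith
  obtain x where x: "x \<in> L - {z}"
    "card T * (card (L - {z}) - (i - 1)) \<le> card (L - {z}) * card {E \<in> T. x \<notin> E}"
  proof (rule ex_point_avoided[of "L - {z}" T "i - 1"])
    fix E assume "E \<in> T"
    then obtain A where A: "A \<in> g" "E = A - {z}" by (auto simp: T_def)
    then show "E \<subseteq> L - {z} \<and> card E = i - 1"
      using g[OF A(1)] card_g[OF A(1)] by (auto simp: card_Diff_singleton)
  next
    show "L - {z} \<noteq> {}" using \<open>card (L - {z}) \<noteq> 0\<close> by force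
  qed (simp_all add: T_def L fin)
  \<comment> \<open>No member of \<open>H\<close> contains the point \<open>x\<close> of
    \<open>L\<close>, so no two of them cover \<open>L\<close>.\<close>
  define H where "H = {E \<in> g. x \<notin> E}"
  have "{E \<in> T. x \<notin> E} = (\<lambda>E. E - {z}) ` H" using x by (auto simp: T_def H_def)
  then have "card {E \<in> T. x \<notin> E} = card H" "card T = card g"
    using card_image[OF inj_on_subset[OF inj, of H]] card_image[OF inj] by (auto simp: T_def H_def)
  with x L' have many: "card g * (card L - 1 - (i - 1)) \<le> (card L - 1) * card H" by simp
  have "(card g - card H) * w i \<le> card H * w (i - 1)"
  proof (cases "g = {}")
    case False
    then obtain E where "E \<in> g" by blast
    then have i: "1 \<le> i" "i \<le> card L"
      using g[OF \<open>E \<in> g\<close>] card_g[OF \<open>E \<in> g\<close>] L card_mono[of L E] finite_subset[of E L]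
      by (auto simp: Suc_le_eq card_gt_0_iff)
    have "(card L - 1) * (card g - card H) \<le> card g * (i - 1)"
      using many unfolding diff_mult_distrib2 mult.commute[of "card L - 1" "card g"] by linarith
    then have "(card L - 1) * ((card g - card H) * w i) \<le> card g * ((i - 1) * w i)"
      by (metis mult.assoc mult_le_mono1)
    also have "\<dots> \<le> card g * ((card L - i) * w (i - 1))"
      using middle[OF True] by simp
    also have "\<dots> \<le> (card L - 1) * (card H * w (i - 1))"
    proof -
      have "card L - 1 - (i - 1) = card L - i" using i by simp
      with many show ?thesis by (metis mult.assoc mult_le_mono1)
    qed
    finally show ?thesis using L by simp
  qed (simp add: H_def)
  moreover have "card (g - H) = card g - card H"
    using fin by (intro card_Diff_subset) (auto simp: H_def)
  moreover have "(\<Sum>E\<in>g - H. w (card E)) = card (g - H) * w i"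
    "(\<Sum>E\<in>H. w (card E - 1)) = card H * w (i - 1)"
    using card_g by (auto simp: H_def)
  ultimately have "(\<Sum>E\<in>g - H. w (card E)) \<le> (\<Sum>E\<in>H. w (card E - 1))" by simp
  moreover have "A \<union> B \<noteq> L" if "A \<in> H" "B \<in> H" for A B
    using that x by (auto simp: H_def)
  moreover have "H \<subseteq> g" by (auto simp: H_def)
  ultimately show ?thesis by (intro that[of H])
qed

text \<open>Conflicts occur only between sizes with sum \<open>card L + t\<close>, so the choice can
  be made separately in each class consisting of a size and its complementary size.\<close>

lemma select_uncrossed:
  fixes g :: "'a set set" and w :: "nat \<Rightarrow> nat"
  assumes L: "finite L" "z \<in> L" "2 \<le> card L"
    and g: "\<And>E. E \<in> g \<Longrightarrow> E \<subseteq> L \<and> z \<in> E"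
    and anti: "\<And>a b. a \<le> b \<Longrightarrow> w b \<le> w a"
    and middle: "\<And>i. 2 * i = card L + t \<Longrightarrow> (i - 1) * w i \<le> (card L - i) * w (i - 1)"
  obtains H where "H \<subseteq> g"
    "\<forall>A\<in>H. \<forall>B\<in>H. card A + card B = card L + t \<longrightarrow> A \<union> B \<noteq> L"
    "(\<Sum>E\<in>g - H. w (card E)) \<le> (\<Sum>E\<in>H. w (card E - 1))"
proof -
  let ?s = "card L + t"
  \<comment> \<open>The label \<open>c\<close> is the smaller of the two complementary sizes, hence
    equal for any two sets that may conflict.\<close>
  define c where "c E = min (card E) (?s - card E)" for E :: "'a set"
  define gc where "gc m = {E \<in> g. c E = m}" for m
  have card_le: "card E \<le> ?s" if "E \<in> g" for E
    using g[OF that] L card_mono[of L E] by simp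
  have "g \<subseteq> Pow L" using g by (meson PowI subsetI)
  then have fin: "finite g" using L by (meson finite_Pow_iff finite_subset)
  have "\<exists>H\<subseteq>gc m. (\<forall>A\<in>H. \<forall>B\<in>H. card A + card B = ?s \<longrightarrow> A \<union> B \<noteq> L)
      \<and> (\<Sum>E\<in>gc m - H. w (card E)) \<le> (\<Sum>E\<in>H. w (card E - 1))" for m
  proof (cases "gc m = {}")
    case False
    then obtain E where "E \<in> g" "c E = m" by (auto simp: gc_def)
    then have m: "m \<le> ?s - m" "m + (?s - m) = ?s"
      using card_le[of E] by (auto simp: c_def min_def split: if_splits)
    obtain H where "H \<subseteq> gc m"
      "\<And>A B. A \<in> H \<Longrightarrow> B \<in> H \<Longrightarrow> card A + card B = ?s \<Longrightarrow> A \<union> B \<noteq> L"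
      "(\<Sum>E\<in>gc m - H. w (card E)) \<le> (\<Sum>E\<in>H. w (card E - 1))"
    proof (rule select_uncrossed_class[of L z "gc m" m "?s - m" t w])
      show "E \<subseteq> L \<and> z \<in> E \<and> (card E = m \<or> card E = ?s - m)" if "E \<in> gc m" for E
        using that g card_le[of E] by (auto simp: gc_def c_def min_def split: if_splits)
    qed (use L m anti middle in auto)
    then show ?thesis by blast
  qed auto
  then obtain P where P: "\<And>m. P m \<subseteq> gc m"
    "\<And>m A B. A \<in> P m \<Longrightarrow> B \<in> P m \<Longrightarrow> card A + card B = ?s \<Longrightarrow> A \<union> B \<noteq> L"
    "\<And>m. (\<Sum>E\<in>gc m - P m. w (card E)) \<le> (\<Sum>E\<in>P m. w (card E - 1))"
    by metis
  define H where "H = {E \<in> g. E \<in> P (c E)}"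
  have group: "sum f S = (\<Sum>m\<in>c ` g. \<Sum>E\<in>{E \<in> S. c E = m}. f E)"
    if "S \<subseteq> g" for S and f :: "'a set \<Rightarrow> nat"
    using that fin finite_subset by (intro sum.group[symmetric]) auto
  have classes: "{E \<in> g - H. c E = m} = gc m - P m" "{E \<in> H. c E = m} = P m" for m
    using P(1)[of m] by (auto simp: H_def gc_def)
  have "g - H \<subseteq> g" "H \<subseteq> g" by (auto simp: H_def)
  then have le: "(\<Sum>E\<in>g - H. w (card E)) \<le> (\<Sum>E\<in>H. w (card E - 1))"
    by (simp only: group[of "g - H"] group[of H] classes) (intro sum_mono P(3))
  have "A \<union> B \<noteq> L" if "A \<in> H" "B \<in> H" "card A + card B = ?s" for A B
  proof -
    have "?s - card A = card B" "?s - card B = card A" using that by auto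
    then have "c A = c B" by (simp add: c_def min.commute)
    then show ?thesis using that P(2)[of A "c A" B] by (auto simp: H_def)
  qed
  with \<open>H \<subseteq> g\<close> le show ?thesis by (intro that[of H]) simp_all
qed

section \<open>Shifting away from a point\<close>

lemma card_exchange:
  assumes "finite A" "z \<in> A" "x \<notin> A"
  shows "card (insert x (A - {z})) = card A"
  using card_Suc_Diff1[OF assms(1,2)] assms by (subst card_insert_disjoint) simp_all

text \<open>Suppose only \<open>A\<close> moves. If \<open>B\<close> was blocked because its image
  is present, that image meets \<open>A\<close> as \<open>B\<close> meets the image of
  \<open>A\<close>. Otherwise \<open>z\<close> is not in \<open>B\<close>, or its loss is made up by
  \<open>x\<close> in \<open>B\<close>.\<close>

lemma intersecting_shift:
  assumes "intersecting t F"
    and fin: "\<And>A. A \<in> F \<Longrightarrow> finite A"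
    and c: "c = compress (\<lambda>A. z \<in> A \<and> x \<notin> A) (\<lambda>A. insert x (A - {z})) F"
    and "x \<noteq> z" and A: "A \<in> F" and B: "B \<in> F"
  shows "t \<le> card (c A \<inter> c B)"
proof -
  note int = intersectingD[OF \<open>intersecting t F\<close>]
  let ?m = "\<lambda>A. insert x (A - {z})"
  have c_move: "c C = ?m C" if "z \<in> C" "x \<notin> C" "?m C \<notin> F" for C
    using that by (simp add: c compress_def)
  have moved: "t \<le> card (?m A \<inter> B)"
    if A: "A \<in> F" and B: "B \<in> F" and xA: "z \<in> A" "x \<notin> A" and stay: "c B = B" for A B
  proof (cases "z \<in> B \<and> x \<notin> B")
    case True
    then have "?m B \<in> F" using stay c_move[of B] by (metis insertI1)
    moreover have "?m A \<inter> B = A \<inter> ?m B" using True xA by auto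
    ultimately show ?thesis using int[OF A] by simp
  next
    case False
    show ?thesis
    proof (cases "z \<in> B")
      case True
      then have eq: "?m A \<inter> B = insert x (A \<inter> B - {z})" using False by auto
      have "card (?m A \<inter> B) = card (A \<inter> B)"
        unfolding eq using True xA fin[OF A] by (intro card_exchange) simp_all
      with int[OF A B] show ?thesis by (simp only:)
    next
      case False
      then have "card (A \<inter> B) \<le> card (?m A \<inter> B)"
        using fin[OF A] by (intro card_mono) auto
      then show ?thesis using int[OF A B] by simp
    qed
  qed
  have c_cases: "c C = C \<or> c C = ?m C \<and> z \<in> C \<and> x \<notin> C" for C
    by (simp add: c compress_def)
  consider "c A = A" "c B = B" | "c A = ?m A" "z \<in> A" "x \<notin> A" "c B = B"
    | "c A = A" "c B = ?m B" "z \<in> B" "x \<notin> B"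
    | "c A = ?m A" "z \<in> A" "x \<notin> A" "c B = ?m B" "z \<in> B" "x \<notin> B"
    using c_cases[of A] c_cases[of B] by argo
  then show ?thesis
  proof cases
    case 1
    show ?thesis unfolding 1 by (rule int[OF A B])
  next
    case 2
    show ?thesis unfolding 2(1,4) by (rule moved[OF A B 2(2-)])
  next
    case 3
    show ?thesis unfolding 3(1,2) Int_commute[of A] by (rule moved[OF B A 3(3,4,1)])
  next
    case 4
    have eq: "?m A \<inter> ?m B = insert x (A \<inter> B - {z})" by auto
    have "card (?m A \<inter> ?m B) = card (A \<inter> B)"
      unfolding eq using 4 fin[OF A] by (intro card_exchange) simp_all
    then show ?thesis unfolding 4(1,4) using int[OF A B] by (simp only:)
  qed
qed

text \<open>Shifts keep all cardinalities, hence the weight, while the number of members containing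
  \<open>z\<close> serves as the decreasing measure.\<close>

lemma ex_shifted:
  fixes U :: "'a set set" and h :: "nat \<Rightarrow> nat"
  assumes L: "finite L" and sub: "U \<subseteq> Pow L"
    and int: "intersecting t U"
  obtains V where "V \<subseteq> Pow L" "intersecting t V"
    "(\<Sum>A\<in>V. h (card A)) = (\<Sum>A\<in>U. h (card A))"
    "\<forall>A\<in>V. \<forall>x\<in>L - A. z \<in> A \<longrightarrow> insert x (A - {z}) \<in> V"
proof -
  define Q where "Q V \<longleftrightarrow> V \<subseteq> Pow L \<and> intersecting t V
      \<and> (\<Sum>A\<in>V. h (card A)) = (\<Sum>A\<in>U. h (card A))" for V
  let ?R = "\<lambda>x A. z \<in> A \<and> x \<notin> A" and ?m = "\<lambda>x A. insert x (A - {z})"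
  have inj: "inj_on (?m x) {A. ?R x A}" for x :: 'a
    by (rule inj_on_inverseI[where g = "\<lambda>B. insert z (B - {x})"]) auto
  have finQ: "finite A" if "Q V" "A \<in> V" for V A
    by (rule finite_subset[of A L]) (use that L in \<open>auto simp: Q_def\<close>)
  obtain V where V: "Q V"
    and stable: "\<And>x A. x \<in> L - {z} \<Longrightarrow> A \<in> V \<Longrightarrow> ?R x A \<Longrightarrow> ?m x A \<in> V"
  proof (rule ex_compression_stable[where Q = Q and F = U and X = "L - {z}" and R = ?R
        and \<phi> = ?m and f = "\<lambda>A. if z \<in> A then 1 else 0"])
    show "Q U" using sub int by (simp add: Q_def)
    show "finite V" if "Q V" for V
      by (rule finite_subset[of V "Pow L"]) (use that L in \<open>simp_all add: Q_def\<close>)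
    show "Q (compress (?R x) (?m x) V ` V)" if V: "Q V" and x: "x \<in> L - {z}" for V x
    proof -
      let ?c = "compress (?R x) (?m x) V"
      have "card (?c A) = card A" if "A \<in> V" for A
        unfolding compress_def using card_exchange[OF finQ[OF V that]] by presburger
      then have "(\<Sum>A\<in>?c ` V. h (card A)) = (\<Sum>A\<in>V. h (card A))"
        by (simp add: sum.reindex inj_on_compress[OF inj])
      moreover have "intersecting t (?c ` V)"
        using intersecting_shift[of t V, OF _ _ refl] V x finQ[OF V]
        by (simp add: Q_def intersecting_def)
      moreover have "?c ` V \<subseteq> Pow L" using V x by (auto simp: Q_def compress_def)
      ultimately show ?thesis using V by (simp add: Q_def)
    qed
    show "(if z \<in> insert x (A - {z}) then 1 else 0) < (if z \<in> A then 1 else 0 :: nat)"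
      if "x \<in> L - {z}" "?R x A" for x A
      using that by auto
  qed (rule inj, blast)
  have "\<forall>A\<in>V. \<forall>x\<in>L - A. z \<in> A \<longrightarrow> insert x (A - {z}) \<in> V"
    by (intro ballI impI stable) auto
  with V show ?thesis by (intro that[of V]) (simp_all add: Q_def)
qed

section \<open>The elimination step\<close>

text \<open>A set without \<open>z\<close> collects two weights, one for itself and one for itself
  with \<open>z\<close> added. The new family consists of the shifted members avoiding
  \<open>z\<close> and the sets \<open>E - {z}\<close> for the selected obstructing
  \<open>E\<close>.\<close>

lemma eliminate_point:
  fixes U :: "'a set set"
  assumes L: "finite L" "z \<in> L" "t < card L" "1 \<le> t"
    and sub: "U \<subseteq> Pow L"
    and int: "intersecting t U"
    and anti: "\<And>a b. a \<le> b \<Longrightarrow> w b \<le> w a"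
    and middle: "\<And>i. 2 * i = card L + t \<Longrightarrow> (i - 1) * w i \<le> (card L - i) * w (i - 1)"
  obtains V where "V \<subseteq> Pow (L - {z})" "intersecting t V"
    "(\<Sum>A\<in>U. w (card A)) \<le> (\<Sum>A\<in>V. w (card A) + w (Suc (card A)) :: nat)"
proof -
  obtain S where S: "S \<subseteq> Pow L" "intersecting t S"
    "(\<Sum>A\<in>S. w (card A)) = (\<Sum>A\<in>U. w (card A))"
    and shifted: "\<forall>A\<in>S. \<forall>x\<in>L - A. z \<in> A \<longrightarrow> insert x (A - {z}) \<in> S"
    by (rule ex_shifted[OF L(1) sub int, where h = w and z = z]) (rule that)
  define S0 where "S0 = {A \<in> S. z \<notin> A}"
  define g where "g = {A \<in> S. z \<in> A \<and> A - {z} \<notin> S}"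
  have finA: "finite A" if "A \<in> S" for A
    by (rule finite_subset[of A L]) (use that S(1) L(1) in auto)
  have finS: "finite S" by (rule finite_subset[OF S(1)]) (simp add: L)
  have g: "E \<subseteq> L \<and> z \<in> E" if "E \<in> g" for E using that S(1) by (auto simp: g_def)
  obtain H where H: "H \<subseteq> g"
    and uncrossed: "\<forall>A\<in>H. \<forall>B\<in>H. card A + card B = card L + t \<longrightarrow> A \<union> B \<noteq> L"
    and gain: "(\<Sum>E\<in>g - H. w (card E)) \<le> (\<Sum>E\<in>H. w (card E - 1))"
  proof (rule select_uncrossed[of L z g w t])
    show "2 \<le> card L" using L by linarith
  qed (use L g anti middle in \<open>simp_all\<close>)
  \<comment> \<open>If a point \<open>x\<close> lay outside both sets, shifting \<open>z\<close> to
    \<open>x\<close> in \<open>A\<close> would leave an intersection of size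
    \<open>t - 1\<close>.\<close>
  have critical: "card A + card B = card L + t \<and> A \<union> B = L"
    if A: "A \<in> g" and B: "B \<in> g" and eq: "card (A \<inter> B) = t" for A B
  proof -
    have "A \<union> B = L"
    proof (rule ccontr)
      assume "A \<union> B \<noteq> L"
      then obtain x where x: "x \<in> L" "x \<notin> A" "x \<notin> B" using g[OF A] g[OF B] by blast
      then have "insert x (A - {z}) \<in> S" using shifted A by (simp add: g_def)
      then have "t \<le> card (insert x (A - {z}) \<inter> B)"
        using B by (intro intersectingD[OF S(2)]) (auto simp: g_def)
      moreover have "insert x (A - {z}) \<inter> B = A \<inter> B - {z}" using x by auto
      moreover have "card (A \<inter> B - {z}) < card (A \<inter> B)"
        using A B finA by (intro psubset_card_mono) (auto simp: g_def)
      ultimately show False using eq by simp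
    qed
    moreover have "card A + card B = card (A \<union> B) + card (A \<inter> B)"
      using A B by (intro card_Un_Int finA) (auto simp: g_def)
    ultimately show ?thesis using eq by simp
  qed
  define D where "D = (\<lambda>E. E - {z}) ` H"
  have disj: "S0 \<inter> D = {}" using H by (auto simp: S0_def D_def g_def)
  have int_del: "t \<le> card (A \<inter> (E - {z}))" if "A \<in> S0" "E \<in> H" for A E
  proof -
    have "A \<inter> (E - {z}) = A \<inter> E" using that by (auto simp: S0_def)
    also have "t \<le> card \<dots>" using that H by (intro intersectingD[OF S(2)]) (auto simp: S0_def g_def)
    finally show ?thesis .
  qed
  \<comment> \<open>The selection excludes intersections of size exactly \<open>t\<close>, so losing
    \<open>z\<close> is affordable.\<close>
  have int_del_del: "t \<le> card ((A - {z}) \<inter> (B - {z}))" if "A \<in> H" "B \<in> H" for A B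
  proof -
    have AB: "A \<in> S" "B \<in> S" "z \<in> A" "z \<in> B" "A \<in> g" "B \<in> g" using that H by (auto simp: g_def)
    have "card (A \<inter> B) \<noteq> t"
      using critical[OF AB(5,6)] uncrossed that by blast
    with intersectingD[OF S(2) AB(1,2)] have "t < card (A \<inter> B)" by linarith
    moreover have "(A - {z}) \<inter> (B - {z}) = A \<inter> B - {z}" by auto
    ultimately show ?thesis using AB by (simp add: card_Diff_singleton)
  qed
  show ?thesis
  proof (rule that[of "S0 \<union> D"])
    show "S0 \<union> D \<subseteq> Pow (L - {z})" using S H by (auto simp: S0_def D_def g_def)
    have "t \<le> card (A \<inter> B)" if AB: "A \<in> S0 \<union> D" "B \<in> S0 \<union> D" for A B
    proof -
      consider "A \<in> S0" "B \<in> S0" | E where "A \<in> S0" "E \<in> H" "B = E - {z}"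
        | E where "B \<in> S0" "E \<in> H" "A = E - {z}"
        | E E' where "E \<in> H" "E' \<in> H" "A = E - {z}" "B = E' - {z}"
        using AB unfolding D_def by blast
      then show ?thesis
      proof cases
        case 1
        then show ?thesis by (intro intersectingD[OF S(2)]) (auto simp: S0_def)
      next
        case 3
        then show ?thesis using int_del[of B E] by (simp add: Int_commute)
      qed (simp_all add: int_del int_del_del)
    qed
    then show "intersecting t (S0 \<union> D)" by (simp add: intersecting_def)
    let ?W = "\<lambda>A. w (card A)" and ?W' = "\<lambda>A. w (Suc (card A))"
    define M where "M = {A \<in> S. z \<in> A \<and> A - {z} \<in> S}"
    have fins: "finite S0" "finite M" "finite g" "finite H" "finite D"
      using finS finite_subset[OF H] by (simp_all add: S0_def M_def g_def D_def)
    have "sum ?W S = sum ?W S0 + sum ?W M + sum ?W g"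
    proof -
      have S_eq: "S = S0 \<union> M \<union> g" and "(S0 \<union> M) \<inter> g = {}" "S0 \<inter> M = {}"
        by (auto simp: S0_def M_def g_def)
      with fins show ?thesis by (subst S_eq) (simp add: sum.union_disjoint)
    qed
    also have "sum ?W g = sum ?W (g - H) + sum ?W H"
      using sum.subset_diff[OF H fins(3)] .
    \<comment> \<open>Removing \<open>z\<close> maps \<open>M\<close> injectively into
      \<open>S0\<close>, where the second weight pays for it.\<close>
    also have "sum ?W M \<le> sum ?W' S0"
    proof -
      have inj: "inj_on (\<lambda>A. A - {z}) M" by (rule inj_on_remove) (simp add: M_def)
      have "Suc (card (A - {z})) = card A" if "A \<in> M" for A
        using that by (intro card_Suc_Diff1 finA) (auto simp: M_def)
      then have "sum ?W M = (\<Sum>A\<in>M. ?W' (A - {z}))"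
        by (intro sum.cong) (simp_all only:)
      also have "\<dots> = sum ?W' ((\<lambda>A. A - {z}) ` M)" by (simp add: sum.reindex inj)
      also have "\<dots> \<le> sum ?W' S0"
        using fins by (intro sum_mono2) (auto simp: M_def S0_def)
      finally show ?thesis .
    qed
    \<comment> \<open>For \<open>E\<close> in \<open>H\<close>, the second weight of
      \<open>E - {z}\<close> is that of \<open>E\<close>; the first is the gain that covers the
      discarded sets.\<close>
    also have "sum ?W (g - H) + sum ?W H \<le> (\<Sum>A\<in>D. ?W A + ?W' A)"
    proof -
      have inj: "inj_on (\<lambda>A. A - {z}) H" using H g by (intro inj_on_remove) blast
      have "Suc (card (E - {z})) = card E" "card (E - {z}) = card E - 1" if "E \<in> H" for E
      proof -
        show "Suc (card (E - {z})) = card E"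
          using that H by (intro card_Suc_Diff1 finA) (auto simp: g_def)
        then show "card (E - {z}) = card E - 1" by linarith
      qed
      then have "(\<Sum>E\<in>H. ?W (E - {z}) + ?W' (E - {z})) = (\<Sum>E\<in>H. w (card E - 1) + ?W E)"
        by (intro sum.cong) (simp_all only:)
      then have "(\<Sum>A\<in>D. ?W A + ?W' A) = (\<Sum>E\<in>H. w (card E - 1)) + sum ?W H"
        unfolding D_def by (simp only: sum.reindex[OF inj] o_def sum.distrib)
      with gain show ?thesis by simp
    qed
    finally show "(\<Sum>A\<in>U. w (card A)) \<le> (\<Sum>A\<in>S0 \<union> D. ?W A + ?W' A)"
      using S(3) fins disj by (simp add: sum.union_disjoint sum.distrib)
  qed
qed

section \<open>Induction on the ground set and conclusion\<close>

text \<open>Points are eliminated until \<open>card L = t\<close>, when only \<open>L\<close> itself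
  can be a member. By \<open>extensions_Suc\<close> the two weights collected at each step add up to
  the weight for the smaller ground set.\<close>

lemma intersecting_weight_bound:
  assumes n: "(k - t + 1) * (t + 1) \<le> n" and t: "1 \<le> t"
    and "finite L" "t \<le> card L" "card L \<le> n" "U \<subseteq> Pow L" "intersecting t U"
  shows "(\<Sum>A\<in>U. extensions k (n - card L) (card A)) \<le> extensions k (n - t) t"
  using assms(3-)
proof (induction "card L" arbitrary: L U)
  case (Suc l)
  show ?case
  proof (cases "t = card L")
    case True
    have "A = L" if "A \<in> U" for A
      using Suc.prems(4) intersectingD[OF Suc.prems(5) that that] that True
      by (intro card_seteq[OF Suc.prems(1)]) auto
    then have "U \<subseteq> {L}" by auto
    then show ?thesis using True by (auto simp: subset_singleton_iff)
  next
    case False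
    then have tL: "t < card L" using Suc.prems by simp
    then obtain z where z: "z \<in> L" by fastforce
    obtain V where V: "V \<subseteq> Pow (L - {z})" "intersecting t V"
      and le: "(\<Sum>A\<in>U. extensions k (n - card L) (card A))
        \<le> (\<Sum>A\<in>V. extensions k (n - card L) (card A) + extensions k (n - card L) (Suc (card A)))"
    proof (rule eliminate_point[of L z t U "extensions k (n - card L)"])
      show "(i - 1) * extensions k (n - card L) i \<le> (card L - i) * extensions k (n - card L) (i - 1)"
        if "2 * i = card L + t" for i
        using extensions_middle[OF n t tL Suc.prems(3) that] .
    qed (use Suc.prems z tL t extensions_antimono in auto)
    have card: "card (L - {z}) = l" using Suc.hyps z Suc.prems by simp
    have "Suc (n - card L) = n - l" using Suc.hyps Suc.prems by simp
    then have "(\<Sum>A\<in>U. extensions k (n - card L) (card A)) \<le> (\<Sum>A\<in>V. extensions k (n - l) (card A))"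
      using le by (simp add: extensions_Suc[symmetric])
    also have "\<dots> \<le> extensions k (n - t) t"
      using Suc.hyps(1)[of "L - {z}" V] card V Suc.prems Suc.hyps(2) tL by simp
    finally show ?thesis .
  qed
qed (use t in simp)

theorem theorem1p2:
  fixes n k t :: nat and F :: "nat set set"
  assumes "t \<ge> 1"
    and "int n \<ge> (int k - int t + 1) * (int t + 1)"
    and "\<forall>A\<in>F. A \<subseteq> {1..n} \<and> card A \<le> k"
    and "\<forall>A\<in>F. \<forall>B\<in>F. card (A \<inter> B) < t \<longrightarrow>
           int (card ((A - B) \<union> (B - A))) \<le> int k - int t"
  shows "card F \<le> (\<Sum>i\<in>{0..<k + 1 - t}. (n - t) choose i)"
proof (cases "t \<le> k")
  case False
  \<comment> \<open>For \<open>k < t\<close>, a member compared with itself would have distance 0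
    bounded by a negative integer.\<close>
  have "F = {}"
  proof (rule ccontr)
    assume "F \<noteq> {}"
    then obtain A where A: "A \<in> F" by blast
    then have "card (A \<inter> A) < t" using assms(3) False by fastforce
    then have "int (card ((A - A) \<union> (A - A))) \<le> int k - int t" using assms(4) A by blast
    then show False using False by simp
  qed
  then show ?thesis by simp
next
  case tk: True
  then have "int ((k - t + 1) * (t + 1)) = (int k - int t + 1) * (int t + 1)"
    by (simp only: of_nat_mult of_nat_add of_nat_diff[OF tk] of_nat_1)
  then have n: "(k - t + 1) * (t + 1) \<le> n" using assms(2) by linarith
  \<comment> \<open>This yields \<open>k \<le> n\<close>, the room needed to enlarge sets up to size
    \<open>k\<close>.\<close>
  obtain m where "k = t + m" using tk le_Suc_ex by blast
  then have "(k - t + 1) * (t + 1) = k + 1 + m * t" by (simp add: algebra_simps)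
  with n have kn: "k \<le> n" by linarith
  have near: "near t k A B" if "A \<in> F" "B \<in> F" for A B
  proof (cases "t \<le> card (A \<inter> B)")
    case False
    then have "int (card ((A - B) \<union> (B - A))) \<le> int k - int t" using assms(4) that by auto
    then show ?thesis by (simp add: near_def)
  qed (simp add: near_def)
  obtain G where G: "card G = card F" "\<forall>A\<in>G. A \<subseteq> {1..n} \<and> card A \<le> k" "intersecting t G"
    by (rule ex_intersecting_of_near[of "{1..n}" k F t]) (use kn assms(3) near in auto)
  \<comment> \<open>On the full ground set no point is free, so the total weight is the size of the
    family.\<close>
  have "extensions k 0 (card A) = 1" if "A \<in> G" for A
  proof -
    have "k + 1 - card A = Suc (k - card A)" using G(2) that by fastforce
    then show ?thesis by (simp add: extensions_def sum.lessThan_Suc_shift del: sum.lessThan_Suc)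
  qed
  then have "card F = (\<Sum>A\<in>G. extensions k (n - card {1..n}) (card A))"
    using G(1) by simp
  also have "\<dots> \<le> extensions k (n - t) t"
    using n assms(1) tk kn G by (intro intersecting_weight_bound) auto
  finally show ?thesis by (simp add: extensions_def lessThan_atLeast0)
qed

end
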